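(* Let $\varphi:\,]a,b[\,\to\mathbb{R}$ be a smooth strictly monotone (strictly increasing or strictly decreasing) function. There is no closed (compact without boundary) $2$-dimensional $[\varphi,\vec e_3]$-minimal immersion $\psi:M\to\mathbb{R}^2\times]a,b[$.
   Context: A dot is the derivative of $\varphi$ in its (height) variable. The immersion $\psi$ is $[\varphi,\vec e_3]$-minimal if its mean curvature vector (trace of the vector-valued second fundamental form) satisfies $\mathbf{H}=\dot\varphi\,\vec e_3^{\,\perp}$, where $\dot\varphi$ is evaluated at the height of the point, $\vec e_3=(0,0,1)$ and $\perp$ is the projection onto the normal bundle. *)

theory Defs
  imports "HOL-Analysis.Analysis"
begin

text \<open>Class \<open>C\<^sup>k\<close> and \<open>C\<^sup>\<infinity>\<close> on an open set, through iterated directional derivatives (only meaningful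
  for open \<open>S\<close>, since derivatives are taken in the full space).\<close>

primrec Ck_on :: "nat \<Rightarrow> 'a set \<Rightarrow> ('a::euclidean_space \<Rightarrow> 'b::euclidean_space) \<Rightarrow> bool" where
  "Ck_on 0 S f \<longleftrightarrow> continuous_on S f"
| "Ck_on (Suc k) S f \<longleftrightarrow> (\<forall>x\<in>S. f differentiable (at x)) \<and>
     (\<forall>v. Ck_on k S (\<lambda>x. frechet_derivative f (at x) v))"

definition smooth_on :: "'a set \<Rightarrow> ('a::euclidean_space \<Rightarrow> 'b::euclidean_space) \<Rightarrow> bool" where
  "smooth_on S f \<longleftrightarrow> (\<forall>k. Ck_on k S f)"

text \<open>A chart is a pair \<open>(U, x)\<close>; the values of \<open>x\<close> outside \<open>U\<close> are irrelevant. Its local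
  parametrization is the inverse of \<open>x\<close>, defined on the open set \<open>x ` U\<close>.
  The atlas need not be maximal. As all charts map onto open subsets of \<open>\<real>\<^sup>n\<close>, a manifold has no
  boundary.\<close>

type_synonym ('m, 'n) chart = "'m set \<times> ('m \<Rightarrow> real ^ 'n)"

definition is_chart :: "'m topology \<Rightarrow> ('m, 'n::finite) chart \<Rightarrow> bool" where
  "is_chart M = (\<lambda>(U, x). openin M U \<and> open (x ` U) \<and>
     homeomorphic_map (subtopology M U) (top_of_set (x ` U)) x)"

definition smooth_atlas :: "'m topology \<Rightarrow> ('m, 'n::finite) chart set \<Rightarrow> bool" where
  "smooth_atlas M A \<longleftrightarrow>
     (\<forall>c\<in>A. is_chart M c) \<and>
     (\<Union>(U, x)\<in>A. U) = topspace M \<and>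
     (\<forall>(U, x)\<in>A. \<forall>(V, y)\<in>A. smooth_on (x ` (U \<inter> V)) (y \<circ> inv_into U x))"

definition smooth_manifold :: "'m topology \<Rightarrow> ('m, 'n::finite) chart set \<Rightarrow> bool" where
  "smooth_manifold M A \<longleftrightarrow> Hausdorff_space M \<and> second_countable M \<and> smooth_atlas M A"

text \<open>Nonemptiness is part of the definition; connectedness is not.\<close>

definition closed_manifold :: "'m topology \<Rightarrow> ('m, 'n::finite) chart set \<Rightarrow> bool" where
  "closed_manifold M A \<longleftrightarrow> smooth_manifold M A \<and> compact_space M \<and> topspace M \<noteq> {}"

definition smooth_immersion ::
    "('m, 'n::finite) chart set \<Rightarrow> ('m \<Rightarrow> 'a::euclidean_space) \<Rightarrow> bool" where
  "smooth_immersion A \<psi> \<longleftrightarrow> (\<forall>(U, x)\<in>A.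
     smooth_on (x ` U) (\<psi> \<circ> inv_into U x) \<and>
     (\<forall>u\<in>x ` U. inj (frechet_derivative (\<psi> \<circ> inv_into U x) (at u))))"

text \<open>Geometry of an immersed parametrization \<open>\<sigma>\<close> (defined near \<open>u\<close>) in Euclidean space.\<close>

definition tangent_space_at :: "(real ^ 'n \<Rightarrow> 'a::euclidean_space) \<Rightarrow> real ^ 'n::finite \<Rightarrow> 'a set" where
  "tangent_space_at \<sigma> u = range (frechet_derivative \<sigma> (at u))"

definition normal_projection ::
    "(real ^ 'n \<Rightarrow> 'a::euclidean_space) \<Rightarrow> real ^ 'n::finite \<Rightarrow> 'a \<Rightarrow> 'a" where
  "normal_projection \<sigma> u w =
     (THE n. n \<in> (tangent_space_at \<sigma> u)\<^sup>\<bottom> \<and> w - n \<in> tangent_space_at \<sigma> u)"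

definition first_fundamental_form ::
    "(real ^ 'n \<Rightarrow> 'a::euclidean_space) \<Rightarrow> real ^ 'n::finite \<Rightarrow> real ^ 'n ^ 'n" where
  "first_fundamental_form \<sigma> u =
     (\<chi> i j. frechet_derivative \<sigma> (at u) (axis i 1) \<bullet> frechet_derivative \<sigma> (at u) (axis j 1))"

text \<open>\<open>II(v, w) = (D\<^sub>v (d\<sigma> w))\<^sup>\<bottom>\<close> with \<open>v\<close>, \<open>w\<close> constant coordinate vector fields and \<open>D\<close> the flat
  connection of the ambient space.\<close>

definition second_fundamental_form ::
    "(real ^ 'n \<Rightarrow> 'a::euclidean_space) \<Rightarrow> real ^ 'n::finite \<Rightarrow> real ^ 'n \<Rightarrow> real ^ 'n \<Rightarrow> 'a" where
  "second_fundamental_form \<sigma> u v w =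
     normal_projection \<sigma> u
       (frechet_derivative (\<lambda>y. frechet_derivative \<sigma> (at y) w) (at u) v)"

text \<open>The trace \<open>g\<^sup>i\<^sup>j II(\<partial>\<^sub>i, \<partial>\<^sub>j)\<close> with respect to the induced metric, not divided by the dimension.\<close>

definition mean_curvature_vector ::
    "(real ^ 'n \<Rightarrow> 'a::euclidean_space) \<Rightarrow> real ^ 'n::finite \<Rightarrow> 'a" where
  "mean_curvature_vector \<sigma> u =
     (\<Sum>i\<in>UNIV. \<Sum>j\<in>UNIV. matrix_inv (first_fundamental_form \<sigma> u) $ i $ j *\<^sub>R
        second_fundamental_form \<sigma> u (axis i 1) (axis j 1))"

definition e3 :: "real ^ 3" where
  "e3 = vector [0, 0, 1]"

definition phi_e3_minimal ::
    "('m, 'n::finite) chart set \<Rightarrow> (real \<Rightarrow> real) \<Rightarrow> ('m \<Rightarrow> real ^ 3) \<Rightarrow> bool" where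
  "phi_e3_minimal A \<phi> \<psi> \<longleftrightarrow> (\<forall>(U, x)\<in>A. \<forall>p\<in>U.
     let \<sigma> = \<psi> \<circ> inv_into U x in
       mean_curvature_vector \<sigma> (x p) = deriv \<phi> (\<psi> p $ 3) *\<^sub>R normal_projection \<sigma> (x p) e3)"

end

theory Submission
  imports Defs
begin

text \<open>Choose a point \<open>c\<close> not above the surface if \<open>\<phi>\<close> is increasing, not below it if \<open>\<phi>\<close>
  is decreasing, and let \<open>p\<close> be a point of the surface at maximal distance from \<open>c\<close>. There
  \<open>D = \<psi> p - c\<close> is normal to the surface, and the second order condition for \<open>\<bar>\<psi> - c\<bar>\<^sup>2\<close> traces to
  \<open>H \<bullet> D \<le> - 2\<close>. But \<open>H \<bullet> D\<close> equals the derivative of \<open>\<phi>\<close> times \<open>e3 \<bullet> D\<close>, and this product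
  is nonnegative by the choice of \<open>c\<close>.\<close>

section \<open>Second-order condition in one variable\<close>

text \<open>The second derivative is only assumed to exist at 0, so the argument uses the mean value
  theorem: if \<open>l\<close> were positive, \<open>f'\<close> would be positive just to the right
  of its zero at 0, and \<open>f\<close> would exceed \<open>f 0\<close> there.\<close>

lemma second_derivative_nonpos_at_local_max:
  fixes f f' :: "real \<Rightarrow> real"
  assumes "\<delta> > 0"
    and f': "\<And>t. \<bar>t\<bar> < \<delta> \<Longrightarrow> (f has_real_derivative f' t) (at t)"
    and f'': "(f' has_real_derivative l) (at 0)"
    and max: "\<And>t. \<bar>t\<bar> < \<delta> \<Longrightarrow> f t \<le> f 0"
  shows "f' 0 = 0" and "l \<le> 0"
proof -
  show f'0: "f' 0 = 0"
    by (rule DERIV_local_max[OF f' \<open>\<delta> > 0\<close>]) (use assms in auto)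
  show "l \<le> 0"
  proof (rule ccontr)
    assume "\<not> l \<le> 0"
    then obtain d where d: "d > 0" "\<And>h. 0 < h \<Longrightarrow> h < d \<Longrightarrow> f' 0 < f' h"
      using DERIV_pos_inc_right[OF f''] by auto
    define t where "t = min d \<delta> / 2"
    have t: "0 < t" "t < d" "t < \<delta>"
      using d(1) \<open>\<delta> > 0\<close> by (auto simp: t_def)
    have "\<exists>z. 0 < z \<and> z < t \<and> f t - f 0 = (t - 0) * f' z"
      by (rule MVT2) (use t f' in auto)
    then obtain z where "0 < z" "z < t" "f t - f 0 = t * f' z"
      by auto
    moreover have "f' z > 0"
      using d(2)[of z] calculation t f'0 by auto
    ultimately have "f t > f 0"
      using t(1) by (smt (verit) mult_pos_pos)
    with max[of t] t show False by auto
  qed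
qed

section \<open>Projection onto the normal space\<close>

text \<open>This justifies the definite description in \<open>normal_projection\<close>.
  Differentiability makes the tangent space a subspace; the orthogonal decomposition gives
  existence, and the difference of two candidates is tangent and normal, hence orthogonal to
  itself.\<close>

lemma normal_projection_orthogonal_decomp:
  fixes \<sigma> :: "real ^ 'n::finite \<Rightarrow> 'a::euclidean_space"
  assumes "\<sigma> differentiable at u"
  shows "normal_projection \<sigma> u w \<in> (tangent_space_at \<sigma> u)\<^sup>\<bottom>"
    and "w - normal_projection \<sigma> u w \<in> tangent_space_at \<sigma> u"
proof -
  let ?T = "tangent_space_at \<sigma> u"
  have T: "subspace ?T"
    unfolding tangent_space_at_def
    by (intro linear_subspace_image subspace_UNIV linear_frechet_derivative assms)
  obtain y z where y: "y \<in> span ?T" and z: "\<And>w. w \<in> span ?T \<Longrightarrow> orthogonal z w" and w: "w = y + z"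
    using orthogonal_subspace_decomp_exists[of ?T w] by metis
  have span: "span ?T = ?T"
    using T by simp
  have "\<exists>!n. n \<in> ?T\<^sup>\<bottom> \<and> w - n \<in> ?T"
  proof (rule ex1I[of _ z])
    show "z \<in> ?T\<^sup>\<bottom> \<and> w - z \<in> ?T"
      using y z w span by (auto simp: orthogonal_comp_def orthogonal_commute)
  next
    fix n assume n: "n \<in> ?T\<^sup>\<bottom> \<and> w - n \<in> ?T"
    have "z - n = (w - n) - y"
      using w by simp
    then have "z - n \<in> ?T"
      using subspace_diff[OF T, of "w - n" y] n y span by metis
    moreover have "z - n \<in> ?T\<^sup>\<bottom>"
      using n z span
      by (intro subspace_diff subspace_orthogonal_comp)
        (auto simp: orthogonal_comp_def orthogonal_commute)
    ultimately have "orthogonal (z - n) (z - n)"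
      by (auto simp: orthogonal_comp_def)
    then show "n = z"
      by (simp add: orthogonal_self)
  qed
  from theI'[OF this]
  show "normal_projection \<sigma> u w \<in> ?T\<^sup>\<bottom>" "w - normal_projection \<sigma> u w \<in> ?T"
    unfolding normal_projection_def by auto
qed

text \<open>Pairing with a normal vector discards the tangential part. Both the mean curvature
  vector and the projection of \<open>e3\<close> can thus be paired with \<open>D\<close> without
  computing any projection.\<close>

lemma inner_normal_projection:
  fixes \<sigma> :: "real ^ 'n::finite \<Rightarrow> 'a::euclidean_space"
  assumes "\<sigma> differentiable at u" and "D \<in> (tangent_space_at \<sigma> u)\<^sup>\<bottom>"
  shows "normal_projection \<sigma> u w \<bullet> D = w \<bullet> D"
proof -
  have "(w - normal_projection \<sigma> u w) \<bullet> D = 0"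
    using normal_projection_orthogonal_decomp(2)[OF assms(1)] assms(2)
    by (auto simp: orthogonal_comp_def orthogonal_def)
  then show ?thesis
    by (simp add: inner_diff_left)
qed

section \<open>Inverses and traces of 2 x 2 matrices\<close>

lemma matrix_inv_mult:
  fixes A :: "'a::semiring_1 ^ 'n ^ 'm"
  assumes "invertible A"
  shows "A ** matrix_inv A = mat 1" and "matrix_inv A ** A = mat 1"
  using someI_ex[OF assms[unfolded invertible_def]] by (simp_all add: matrix_inv_def)

lemma matrix_inv_eqI:
  fixes A :: "'a::semiring_1 ^ 'n ^ 'm"
  assumes "A ** B = mat 1" and "B ** A = mat 1"
  shows "matrix_inv A = B"
proof -
  have "invertible A"
    using assms by (auto simp: invertible_def)
  then show ?thesis
    by (metis assms(2) matrix_inv_mult(1) matrix_mul_assoc matrix_mul_lid matrix_mul_rid)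
qed

text \<open>The right-hand side is the adjugate over the determinant. In the index type
  \<open>2\<close>, the map \<open>i \<mapsto> 3 - i\<close> swaps 1 and 2.\<close>

lemma matrix_inv_2:
  fixes G :: "real ^ 2 ^ 2"
  assumes "det G \<noteq> 0"
  shows "matrix_inv G = (\<chi> i j. (if i = j then G $ (3 - i) $ (3 - i) else - G $ i $ j) / det G)"
proof (rule matrix_inv_eqI)
  let ?H = "\<chi> i j. (if i = j then G $ (3 - i) $ (3 - i) else - G $ i $ j) / det G"
  have [simp]: "(3 :: 2) - 2 = 1" "(3 :: 2) - 1 = 2"
    by simp_all
  show "G ** ?H = mat 1" "?H ** G = mat 1"
    using assms
    by (simp_all add: vec_eq_iff matrix_matrix_mult_def mat_def sum_2 forall_2
        add_divide_distrib[symmetric] diff_divide_distrib[symmetric])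
      (simp_all add: det_2 algebra_simps)
qed

text \<open>A negative semidefinite form has nonpositive trace with respect to a positive definite
  \<open>G\<close>. Since \<open>G\<close> is symmetric, the mixed entries of \<open>N\<close> enter
  only through their sum, so the lemma applies to second derivatives without first showing that they
  commute.\<close>

lemma trace_matrix_inv_mult_nonpos_2:
  fixes G N :: "real ^ 2 ^ 2"
  assumes sym: "G $ 1 $ 2 = G $ 2 $ 1"
    and pos: "G $ 2 $ 2 > 0" "det G > 0"
    and N: "\<And>\<alpha> \<beta>. \<alpha>\<^sup>2 * N $ 1 $ 1 + \<alpha> * \<beta> * (N $ 1 $ 2 + N $ 2 $ 1) + \<beta>\<^sup>2 * N $ 2 $ 2 \<le> 0"
  shows "(\<Sum>i\<in>UNIV. \<Sum>j\<in>UNIV. matrix_inv G $ i $ j * N $ i $ j) \<le> 0"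
proof -
  define g11 g12 g22 where "g11 = G $ 1 $ 1" and "g12 = G $ 2 $ 1" and "g22 = G $ 2 $ 2"
  define S where "S = g22 * N $ 1 $ 1 - g12 * (N $ 1 $ 2 + N $ 2 $ 1) + g11 * N $ 2 $ 2"
  have det: "det G = g11 * g22 - g12 * g12"
    by (simp add: det_2 sym g11_def g12_def g22_def)
  \<comment> \<open>\<open>S\<close> is the trace multiplied by \<open>det G\<close>. Completing the
    square writes \<open>g22 * S\<close> as the form \<open>N\<close> at the vector
    \<open>(g22, - g12)\<close> plus a multiple of \<open>N $ 2 $ 2\<close>, and both terms are
    nonpositive.\<close>
  have "g22 * S = (g22\<^sup>2 * N $ 1 $ 1 + g22 * (- g12) * (N $ 1 $ 2 + N $ 2 $ 1) + (- g12)\<^sup>2 * N $ 2 $ 2)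
      + det G * N $ 2 $ 2"
    unfolding S_def det by (simp add: algebra_simps power2_eq_square)
  moreover have "N $ 2 $ 2 \<le> 0"
    using N[of 0 1] by simp
  then have "det G * N $ 2 $ 2 \<le> 0"
    using pos(2) by (simp add: mult_nonneg_nonpos)
  ultimately have "g22 * S \<le> 0"
    using N[of g22 "- g12"] by linarith
  then have "S \<le> 0"
    using pos(1) by (simp add: g22_def mult_le_0_iff)
  have [simp]: "(3 :: 2) - 2 = 1" "(3 :: 2) - 1 = 2"
    by simp_all
  have "(\<Sum>i\<in>UNIV. \<Sum>j\<in>UNIV. matrix_inv G $ i $ j * N $ i $ j) = S / det G"
    using pos(2) by (simp add: matrix_inv_2 sum_2 S_def sym g11_def g12_def g22_def
        add_divide_distrib diff_divide_distrib distrib_left)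
  also have "\<dots> \<le> 0"
    using \<open>S \<le> 0\<close> pos(2) by (simp add: divide_nonpos_pos)
  finally show ?thesis .
qed

section \<open>Geometry at a point of maximal distance\<close>

text \<open>These are the first and second order conditions in one variable for the squared distance
  to \<open>c\<close> along the line through \<open>u\<close> in direction \<open>v\<close>; each
  derivative is halved.\<close>

lemma derivatives_at_max_distance:
  fixes \<sigma> :: "real ^ 'n::finite \<Rightarrow> 'a::euclidean_space"
  assumes W: "open W" "u \<in> W"
    and C2: "Ck_on 2 W \<sigma>"
    and max: "\<And>w. w \<in> W \<Longrightarrow> dist (\<sigma> w) c \<le> dist (\<sigma> u) c"
  shows "frechet_derivative \<sigma> (at u) v \<bullet> (\<sigma> u - c) = 0"
    and "frechet_derivative (\<lambda>y. frechet_derivative \<sigma> (at y) v) (at u) v \<bullet> (\<sigma> u - c)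
      + (norm (frechet_derivative \<sigma> (at u) v))\<^sup>2 \<le> 0"
proof -
  define P where "P = (\<lambda>y. frechet_derivative \<sigma> (at y))"
  have \<sigma>: "(\<sigma> has_derivative P y) (at y)" if "y \<in> W" for y
    using C2 that frechet_derivative_works[of \<sigma> "at y"] by (auto simp: P_def numeral_2_eq_2)
  have P: "((\<lambda>y. P y v) has_derivative frechet_derivative (\<lambda>y. P y v) (at u)) (at u)"
    using C2 W(2) frechet_derivative_works[of "\<lambda>y. P y v" "at u"]
    by (auto simp: P_def numeral_2_eq_2)
  have "continuous (at 0) (\<lambda>t::real. u + t *\<^sub>R v)"
    by (intro continuous_intros)
  then have "((\<lambda>t::real. u + t *\<^sub>R v) \<longlongrightarrow> u) (at 0)"
    by (simp add: continuous_at)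
  then have "eventually (\<lambda>t::real. u + t *\<^sub>R v \<in> W) (at 0)"
    using topological_tendstoD W by blast
  then obtain \<delta> where \<delta>: "\<delta> > 0" "\<And>t::real. t \<noteq> 0 \<Longrightarrow> \<bar>t\<bar> < \<delta> \<Longrightarrow> u + t *\<^sub>R v \<in> W"
    unfolding eventually_at by (auto simp: dist_real_def)
  \<comment> \<open>The filter \<open>at 0\<close> is punctured, so \<open>t = 0\<close> is supplied
    by \<open>u \<in> W\<close>.\<close>
  then have line_in: "u + t *\<^sub>R v \<in> W" if "\<bar>t\<bar> < \<delta>" for t :: real
    using that W(2) by (cases "t = 0") auto
  \<comment> \<open>Squaring keeps the function differentiable even where \<open>\<sigma>\<close>
    meets \<open>c\<close>.\<close>
  define f where "f = (\<lambda>t::real. (\<sigma> (u + t *\<^sub>R v) - c) \<bullet> (\<sigma> (u + t *\<^sub>R v) - c))"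
  define f' where "f' = (\<lambda>t::real. 2 * (P (u + t *\<^sub>R v) v \<bullet> (\<sigma> (u + t *\<^sub>R v) - c)))"
  have line: "((\<lambda>t::real. u + t *\<^sub>R v) has_derivative (\<lambda>t. t *\<^sub>R v)) (at t)" for t
    by (auto intro!: derivative_eq_intros)
  have \<sigma>_line: "((\<lambda>t. \<sigma> (u + t *\<^sub>R v)) has_derivative (\<lambda>s. s *\<^sub>R P (u + t *\<^sub>R v) v)) (at t)"
    if "\<bar>t\<bar> < \<delta>" for t
    using has_derivative_compose[OF line \<sigma>[OF line_in[OF that]]]
      linear_cmul[OF has_derivative_linear[OF \<sigma>[OF line_in[OF that]]]] by (simp add: o_def)
  have f': "(f has_real_derivative f' t) (at t)" if "\<bar>t\<bar> < \<delta>" for t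
    unfolding has_field_derivative_def f_def
    by (rule has_derivative_eq_rhs, (rule derivative_intros \<sigma>_line that)+)
      (auto simp: f'_def inner_commute algebra_simps fun_eq_iff)
  have P_line: "((\<lambda>t. P (u + t *\<^sub>R v) v) has_derivative
      (\<lambda>s. s *\<^sub>R frechet_derivative (\<lambda>y. P y v) (at u) v)) (at 0)"
  proof -
    have "((\<lambda>y. P y v) has_derivative frechet_derivative (\<lambda>y. P y v) (at u)) (at (u + 0 *\<^sub>R v))"
      using P by simp
    from has_derivative_compose[OF line this] show ?thesis
      using linear_cmul[OF has_derivative_linear[OF P]] by simp
  qed
  have \<sigma>_line0: "((\<lambda>t. \<sigma> (u + t *\<^sub>R v)) has_derivative (\<lambda>s. s *\<^sub>R P u v)) (at 0)"
    using \<sigma>_line[of 0] \<delta>(1) by simp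
  have f'': "(f' has_real_derivative
      2 * (frechet_derivative (\<lambda>y. P y v) (at u) v \<bullet> (\<sigma> u - c) + (norm (P u v))\<^sup>2)) (at 0)"
    unfolding has_field_derivative_def f'_def
    by (rule has_derivative_eq_rhs, (rule derivative_intros \<sigma>_line0 P_line)+)
      (use \<delta>(1) in \<open>auto simp: algebra_simps fun_eq_iff power2_norm_eq_inner\<close>)
  have "f t \<le> f 0" if "\<bar>t\<bar> < \<delta>" for t
    using power_mono[OF max[OF line_in[OF that]], of 2]
    by (simp add: f_def dist_norm power2_norm_eq_inner)
  note second_derivative_nonpos_at_local_max[OF \<delta>(1) f' f'' this]
  then show "frechet_derivative \<sigma> (at u) v \<bullet> (\<sigma> u - c) = 0"
    and "frechet_derivative (\<lambda>y. frechet_derivative \<sigma> (at y) v) (at u) v \<bullet> (\<sigma> u - c)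
      + (norm (frechet_derivative \<sigma> (at u) v))\<^sup>2 \<le> 0"
    by (simp_all add: f'_def P_def)
qed

text \<open>The form \<open>B v w \<bullet> D + P u v \<bullet> P u w\<close> is negative
  semidefinite on the diagonal by the second order condition. Its trace with respect to the induced
  metric is \<open>H \<bullet> D + 2\<close>, where 2 is the trace of the metric against itself,
  that is, the dimension.\<close>

lemma mean_curvature_at_max_distance:
  fixes \<sigma> :: "real ^ 2 \<Rightarrow> 'a::euclidean_space"
  assumes W: "open W" "u \<in> W"
    and C2: "Ck_on 2 W \<sigma>"
    and inj: "inj (frechet_derivative \<sigma> (at u))"
    and max: "\<And>w. w \<in> W \<Longrightarrow> dist (\<sigma> w) c \<le> dist (\<sigma> u) c"
  shows "\<sigma> u - c \<in> (tangent_space_at \<sigma> u)\<^sup>\<bottom>"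
    and "mean_curvature_vector \<sigma> u \<bullet> (\<sigma> u - c) \<le> - 2"
proof -
  define D where "D = \<sigma> u - c"
  define P where "P = (\<lambda>y. frechet_derivative \<sigma> (at y))"
  define e where "e = (\<lambda>i::2. axis i (1::real))"
  define B where "B = (\<lambda>v w. frechet_derivative (\<lambda>y. P y w) (at u) v)"
  define G where "G = first_fundamental_form \<sigma> u"
  define N where "N = (\<chi> i j. B (e i) (e j) \<bullet> D + G $ i $ j)"
  have diff: "\<sigma> differentiable at y" if "y \<in> W" for y
    using C2 that by (auto simp: numeral_2_eq_2)
  have lin: "linear (P y)" if "y \<in> W" for y
    unfolding P_def by (rule linear_frechet_derivative[OF diff[OF that]])
  have B: "((\<lambda>y. P y w) has_derivative (\<lambda>v. B v w)) (at u)" for w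
    using C2 W(2) frechet_derivative_works[of "\<lambda>y. P y w" "at u"]
    by (auto simp: P_def B_def numeral_2_eq_2)
  have B_left: "linear (\<lambda>v. B v w)" for w
    by (rule has_derivative_linear[OF B])
  \<comment> \<open>\<open>Ck_on\<close> treats each direction \<open>w\<close> separately, so
    linearity in \<open>w\<close> has to be derived: \<open>P y\<close> is linear for all
    \<open>y\<close> in the neighbourhood \<open>W\<close> of \<open>u\<close>, and derivatives are
    unique.\<close>
  have B_right: "B v (\<alpha> *\<^sub>R w + \<beta> *\<^sub>R w') = \<alpha> *\<^sub>R B v w + \<beta> *\<^sub>R B v w'" for v w w' \<alpha> \<beta>
  proof -
    have "((\<lambda>y. \<alpha> *\<^sub>R P y w + \<beta> *\<^sub>R P y w') has_derivative (\<lambda>v. \<alpha> *\<^sub>R B v w + \<beta> *\<^sub>R B v w')) (at u)"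
      by (intro derivative_intros B)
    then have "((\<lambda>y. P y (\<alpha> *\<^sub>R w + \<beta> *\<^sub>R w')) has_derivative
        (\<lambda>v. \<alpha> *\<^sub>R B v w + \<beta> *\<^sub>R B v w')) (at u)"
      by (rule has_derivative_transform_within_open[OF _ W])
        (simp add: linear_add[OF lin] linear_cmul[OF lin])
    from has_derivative_unique[OF this B] show ?thesis
      by (metis)
  qed
  have critical: "P u v \<bullet> D = 0" for v
    using derivatives_at_max_distance(1)[OF W C2 max] by (simp add: P_def D_def)
  have hess: "B v v \<bullet> D + P u v \<bullet> P u v \<le> 0" for v
    using derivatives_at_max_distance(2)[OF W C2 max]
    by (simp add: P_def D_def B_def power2_norm_eq_inner)
  show normal: "\<sigma> u - c \<in> (tangent_space_at \<sigma> u)\<^sup>\<bottom>"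
    using critical
    by (auto simp: orthogonal_comp_def orthogonal_def tangent_space_at_def P_def D_def)
  have G: "G $ i $ j = P u (e i) \<bullet> P u (e j)" for i j
    by (simp add: G_def first_fundamental_form_def P_def e_def)
  have P_nz: "P u v \<noteq> 0" if "v \<noteq> 0" for v
    using inj linear_injective_0[OF lin[OF W(2)]] that by (auto simp: P_def)
  have comb_nz: "\<alpha> *\<^sub>R e 1 + \<beta> *\<^sub>R e 2 \<noteq> 0" if "\<alpha> \<noteq> 0 \<or> \<beta> \<noteq> 0" for \<alpha> \<beta>
    using that by (auto simp: vec_eq_iff e_def axis_def forall_2)
  have sym: "G $ 1 $ 2 = G $ 2 $ 1"
    by (simp add: G inner_commute)
  have "P u (e 2) \<noteq> 0"
    using P_nz[of "e 2"] comb_nz[of 0 1] by simp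
  then have G22: "G $ 2 $ 2 > 0"
    by (simp add: G)
  have detG: "det G > 0"
  proof -
    \<comment> \<open>With these coefficients the squared length of \<open>w\<close> equals
      \<open>G $ 2 $ 2 * det G\<close>; it is positive because the differential is
      injective.\<close>
    define \<alpha> \<beta> where "\<alpha> = G $ 2 $ 2" and "\<beta> = - G $ 1 $ 2"
    define w where "w = P u (\<alpha> *\<^sub>R e 1 + \<beta> *\<^sub>R e 2)"
    have w: "w = \<alpha> *\<^sub>R P u (e 1) + \<beta> *\<^sub>R P u (e 2)"
      by (simp add: w_def linear_add[OF lin[OF W(2)]] linear_cmul[OF lin[OF W(2)]])
    have "w \<noteq> 0"
      unfolding w_def using G22 by (intro P_nz comb_nz) (auto simp: \<alpha>_def)
    then have "0 < w \<bullet> w"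
      by simp
    also have "w \<bullet> w = \<alpha>\<^sup>2 * G $ 1 $ 1 + 2 * \<alpha> * \<beta> * G $ 1 $ 2 + \<beta>\<^sup>2 * G $ 2 $ 2"
      unfolding w by (simp add: G inner_add_left inner_add_right inner_commute power2_eq_square)
    also have "\<dots> = G $ 2 $ 2 * det G"
      by (simp add: \<alpha>_def \<beta>_def det_2 sym power2_eq_square algebra_simps)
    finally show ?thesis
      using G22 by (simp add: zero_less_mult_iff)
  qed
  have "\<alpha>\<^sup>2 * N $ 1 $ 1 + \<alpha> * \<beta> * (N $ 1 $ 2 + N $ 2 $ 1) + \<beta>\<^sup>2 * N $ 2 $ 2 \<le> 0" for \<alpha> \<beta>
  proof -
    let ?v = "\<alpha> *\<^sub>R e 1 + \<beta> *\<^sub>R e 2"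
    have "B ?v ?v \<bullet> D + P u ?v \<bullet> P u ?v =
        \<alpha>\<^sup>2 * N $ 1 $ 1 + \<alpha> * \<beta> * (N $ 1 $ 2 + N $ 2 $ 1) + \<beta>\<^sup>2 * N $ 2 $ 2"
      by (simp add: B_right linear_add[OF B_left] linear_cmul[OF B_left] N_def G
          linear_add[OF lin[OF W(2)]] linear_cmul[OF lin[OF W(2)]] inner_add_left inner_add_right
          power2_eq_square algebra_simps)
    with hess[of ?v] show ?thesis by simp
  qed
  from trace_matrix_inv_mult_nonpos_2[OF sym G22 detG this]
  have "0 \<ge> (\<Sum>i\<in>UNIV. \<Sum>j\<in>UNIV. matrix_inv G $ i $ j * (B (e i) (e j) \<bullet> D))
      + (\<Sum>i\<in>UNIV. \<Sum>j\<in>UNIV. matrix_inv G $ i $ j * G $ i $ j)"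
    by (simp add: N_def distrib_left sum.distrib)
  \<comment> \<open>\<open>D\<close> is normal, so the projections inside the second fundamental
    form drop out.\<close>
  moreover have "mean_curvature_vector \<sigma> u \<bullet> D
      = (\<Sum>i\<in>UNIV. \<Sum>j\<in>UNIV. matrix_inv G $ i $ j * (B (e i) (e j) \<bullet> D))"
    using inner_normal_projection[OF diff[OF W(2)] normal]
    by (simp add: mean_curvature_vector_def inner_sum_left second_fundamental_form_def
        G_def B_def P_def e_def D_def)
  moreover have "(\<Sum>i\<in>UNIV. \<Sum>j\<in>UNIV. matrix_inv G $ i $ j * G $ i $ j) = 2"
  proof -
    have "invertible G"
      using detG by (simp add: invertible_det_nz)
    then have "matrix_inv G ** G = mat 1"
      by (simp add: matrix_inv_mult(2))
    moreover have "G $ i $ j = G $ j $ i" for i j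
      by (simp add: G inner_commute)
    then have "(\<Sum>i\<in>UNIV. \<Sum>j\<in>UNIV. matrix_inv G $ i $ j * G $ i $ j)
        = (\<Sum>i\<in>UNIV. (matrix_inv G ** G) $ i $ i)"
      by (simp add: matrix_matrix_mult_def)
    ultimately show ?thesis
      by (simp add: mat_def)
  qed
  ultimately show "mean_curvature_vector \<sigma> u \<bullet> (\<sigma> u - c) \<le> - 2"
    by (simp add: D_def)
qed

section \<open>Continuity of the immersion and the sign of the derivative of
  \<open>\<phi>\<close>\<close>

text \<open>Compactness of the image needs global continuity, whereas smoothness is stated in
  charts. On a chart domain \<open>\<psi>\<close> is its coordinate expression composed with the
  chart map; the domains form an open cover, so the pieces paste together.\<close>

lemma continuous_map_smooth_immersion:
  assumes atlas: "smooth_atlas M A" and imm: "smooth_immersion A \<psi>"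
  shows "continuous_map M euclidean \<psi>"
proof (rule pasting_lemma[where I = A and T = fst and f = "\<lambda>_. \<psi>"])
  fix c assume c: "c \<in> A"
  obtain U x where Ux: "c = (U, x)"
    by (cases c)
  have "is_chart M c"
    using atlas c by (auto simp: smooth_atlas_def)
  then have U: "openin M U" and homeo: "homeomorphic_map (subtopology M U) (top_of_set (x ` U)) x"
    by (auto simp: is_chart_def Ux)
  show "openin M (fst c)"
    using U Ux by simp
  have "topspace (subtopology M U) = U"
    using openin_subset[OF U] by auto
  then have inj: "inj_on x U"
    using homeomorphic_imp_injective_map[OF homeo] by simp
  have "smooth_on (x ` U) (\<psi> \<circ> inv_into U x)"
    using imm c Ux by (auto simp: smooth_immersion_def)
  then have "Ck_on 0 (x ` U) (\<psi> \<circ> inv_into U x)"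
    unfolding smooth_on_def by blast
  then have "continuous_map (top_of_set (x ` U)) euclidean (\<psi> \<circ> inv_into U x)"
    by simp
  from continuous_map_compose[OF homeomorphic_imp_continuous_map[OF homeo] this]
  have "continuous_map (subtopology M U) euclidean (\<psi> \<circ> inv_into U x \<circ> x)" .
  then show "continuous_map (subtopology M (fst c)) euclidean \<psi>"
    unfolding Ux fst_conv by (rule continuous_map_eq) (use inj in auto)
next
  fix p assume "p \<in> topspace M"
  then have "p \<in> (\<Union>(U, x)\<in>A. U)"
    using atlas by (simp add: smooth_atlas_def)
  then show "\<exists>c. c \<in> A \<and> p \<in> fst c \<and> \<psi> p = \<psi> p"
    by force
qed auto

text \<open>The sign \<open>s\<close> lets both kinds of monotonicity share one argument. The
  inequality is weak because the derivative of a strictly monotone function may vanish; the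
  strictness of the final contradiction comes from the bound \<open>- 2\<close>.\<close>

lemma deriv_sgn_of_monotone_on_einterval:
  fixes \<phi> :: "real \<Rightarrow> real"
  assumes smooth: "smooth_on (einterval a b) \<phi>"
    and mono: "strict_mono_on (einterval a b) \<phi> \<or> strict_antimono_on (einterval a b) \<phi>"
  obtains s :: real where "s = 1 \<or> s = - 1" and "\<And>h. h \<in> einterval a b \<Longrightarrow> s * deriv \<phi> h \<ge> 0"
proof -
  have "Ck_on 1 (einterval a b) \<phi>"
    using smooth unfolding smooth_on_def by blast
  then have "\<phi> differentiable at h" if "h \<in> einterval a b" for h
    using that by simp
  then have \<phi>: "(\<phi> has_real_derivative deriv \<phi> h) (at h)" if "h \<in> einterval a b" for h
    using that by (metis DERIV_deriv_iff_real_differentiable)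
  have interior: "interior (einterval a b) = einterval a b"
    by (rule interior_open) simp
  from mono show ?thesis
  proof
    assume "strict_mono_on (einterval a b) \<phi>"
    then have "deriv \<phi> h \<ge> 0" if "h \<in> einterval a b" for h
      using mono_on_imp_deriv_nonneg[OF strict_mono_on_imp_mono_on \<phi>] that interior by auto
    with that[of 1] show ?thesis by simp
  next
    assume "strict_antimono_on (einterval a b) \<phi>"
    then have "mono_on (einterval a b) (\<lambda>x. - \<phi> x)"
      by (auto simp: monotone_on_def le_less)
    then have "- deriv \<phi> h \<ge> 0" if "h \<in> einterval a b" for h
      using mono_on_imp_deriv_nonneg[OF _ DERIV_minus[OF \<phi>]] that interior by auto
    with that[of "- 1"] show ?thesis by simp
  qed
qed

section \<open>Contradiction at the farthest point\<close>

theorem corollary2p3: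
  fixes \<phi> :: "real \<Rightarrow> real" and a b :: ereal
  assumes "a < b"
    and "smooth_on (einterval a b) \<phi>"
    and "strict_mono_on (einterval a b) \<phi> \<or> strict_antimono_on (einterval a b) \<phi>"
  shows "\<not> (\<exists>(M :: 'm topology) (A :: ('m, 2) chart set) (\<psi> :: 'm \<Rightarrow> real ^ 3).
           closed_manifold M A \<and>
           smooth_immersion A \<psi> \<and>
           (\<forall>p\<in>topspace M. \<psi> p $ 3 \<in> einterval a b) \<and>
           phi_e3_minimal A \<phi> \<psi>)"
proof (rule notI, elim exE conjE)
  fix M :: "'m topology" and A :: "('m, 2) chart set" and \<psi> :: "'m \<Rightarrow> real ^ 3"
  assume M: "closed_manifold M A" and imm: "smooth_immersion A \<psi>"
    and height: "\<forall>p\<in>topspace M. \<psi> p $ 3 \<in> einterval a b" and minimal: "phi_e3_minimal A \<phi> \<psi>"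
  have atlas: "smooth_atlas M A" and compact: "compact_space M" and nonempty: "topspace M \<noteq> {}"
    using M by (auto simp: closed_manifold_def smooth_manifold_def)
  obtain s where s: "s = 1 \<or> s = - 1" "\<And>h. h \<in> einterval a b \<Longrightarrow> s * deriv \<phi> h \<ge> 0"
    using deriv_sgn_of_monotone_on_einterval[OF assms(2,3)] by blast
  let ?K = "\<psi> ` topspace M"
  have K: "compact ?K"
    using image_compactin[OF _ continuous_map_smooth_immersion[OF atlas imm], of "topspace M"] compact
    by (simp add: compact_space_def)
  obtain R where R: "\<And>y. y \<in> ?K \<Longrightarrow> norm y \<le> R"
    using compact_imp_bounded[OF K] unfolding bounded_iff by blast
  \<comment> \<open>\<open>R\<close> bounds the norm on the surface, so height
    \<open>- s * R\<close> puts \<open>c\<close> weakly below the surface for \<open>s = 1\<close>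
    and weakly above it for \<open>s = - 1\<close>. The point \<open>c\<close> may leave the slab,
    since the derivative of \<open>\<phi>\<close> is evaluated only at heights of the
    surface.\<close>
  define c where "c = (- s * R) *\<^sub>R e3"
  have e3: "v \<bullet> e3 = v $ 3" for v
    by (simp add: e3_def inner_vec_def sum_3)
  have above: "s * ((\<psi> p - c) $ 3) \<ge> 0" if "p \<in> topspace M" for p
  proof -
    have "\<bar>\<psi> p $ 3\<bar> \<le> R"
      using R[of "\<psi> p"] component_le_norm_cart[of "\<psi> p" 3] that by force
    then show ?thesis
      using s(1) by (auto simp: c_def e3_def)
  qed
  have "continuous_on ?K (\<lambda>y. dist y c)"
    by (intro continuous_intros)
  then obtain p where p: "p \<in> topspace M"
    and max: "\<And>q. q \<in> topspace M \<Longrightarrow> dist (\<psi> q) c \<le> dist (\<psi> p) c"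
    using continuous_attains_sup[OF K, of "\<lambda>y. dist y c"] nonempty by auto
  have "p \<in> (\<Union>(U, x)\<in>A. U)"
    using atlas p by (simp add: smooth_atlas_def)
  then obtain U x where Ux: "(U, x) \<in> A" and pU: "p \<in> U"
    by blast
  have chart: "openin M U" "open (x ` U)"
      "homeomorphic_map (subtopology M U) (top_of_set (x ` U)) x"
    using atlas Ux by (auto simp: smooth_atlas_def is_chart_def)
  have "topspace (subtopology M U) = U"
    using openin_subset[OF chart(1)] by auto
  then have inj_x: "inj_on x U"
    using homeomorphic_imp_injective_map[OF chart(3)] by simp
  define \<sigma> where "\<sigma> = \<psi> \<circ> inv_into U x"
  define u where "u = x p"
  have \<sigma>u: "\<sigma> u = \<psi> p"
    using inj_x pU by (simp add: \<sigma>_def u_def)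
  have u: "u \<in> x ` U"
    using pU by (simp add: u_def)
  have C2: "Ck_on 2 (x ` U) \<sigma>" and inj: "inj (frechet_derivative \<sigma> (at u))"
    using imm Ux u unfolding smooth_immersion_def smooth_on_def \<sigma>_def by blast+
  \<comment> \<open>The global maximum at \<open>p\<close> is in particular a maximum over the open
    coordinate domain, where the local result applies.\<close>
  have "dist (\<sigma> w) c \<le> dist (\<sigma> u) c" if "w \<in> x ` U" for w
    using max[of "inv_into U x w"] inv_into_into[OF that] openin_subset[OF chart(1)]
    unfolding \<sigma>u by (auto simp: \<sigma>_def)
  note max_dist = mean_curvature_at_max_distance[OF chart(2) u C2 inj this]
  have diff: "\<sigma> differentiable at u"
    using C2 u unfolding numeral_2_eq_2 Ck_on.simps by blast
  have "mean_curvature_vector \<sigma> u = deriv \<phi> (\<psi> p $ 3) *\<^sub>R normal_projection \<sigma> u e3"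
    using minimal Ux pU unfolding phi_e3_minimal_def Let_def \<sigma>_def u_def by fast
  then have "mean_curvature_vector \<sigma> u \<bullet> (\<sigma> u - c) = deriv \<phi> (\<psi> p $ 3) * ((\<psi> p - c) $ 3)"
    using inner_normal_projection[OF diff max_dist(1)] by (simp add: \<sigma>u e3 inner_commute[of e3])
  \<comment> \<open>Inserting \<open>s * s = 1\<close> splits the product into two nonnegative
    factors, one from the monotonicity of \<open>\<phi>\<close> and one from the position of
    \<open>c\<close>.\<close>
  also have "\<dots> = (s * deriv \<phi> (\<psi> p $ 3)) * (s * ((\<psi> p - c) $ 3))"
    using s(1) by auto
  also have "\<dots> \<ge> 0"
    using s(2) height above[OF p] p by (metis mult_nonneg_nonneg)
  finally show False
    using max_dist(2) by linarith
qed

end
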